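(* Let $d\ge 1$, let $G=\mathrm{PSL}_2(\mathbb{R})=\mathrm{SL}_2(\mathbb{R})/\{\pm 1\}$, and let $w\in F_d$ be any nontrivial word. Then the image of the word map $\tilde w\colon G^d\to G$ contains all split semisimple elements of $G$. Moreover, if the image of $\tilde w$ contains an involution (an element of order $2$), then the image of $\tilde w$ contains all semisimple elements of $G$.
   Context: $F_d$ denotes the free group on $d$ generators $x_1,\dots,x_d$. For a group $G$ and a word $w=w(x_1,\dots,x_d)\in F_d$, the word map $\tilde w\colon G^d\to G$ is the evaluation map sending $(g_1,\dots,g_d)$ to $w(g_1,\dots,g_d)$. An element of $\mathrm{SL}_2(\mathbb{R})$ is semisimple if it is diagonalizable over $\mathbb{C}$; it is split semisimple if it lies in a split torus, i.e. is conjugate in $\mathrm{SL}_2(\mathbb{R})$ to $\mathrm{diag}(\alpha,\alpha^{-1})$ for some $\alpha\in\mathbb{R}^*$. An element of $\mathrm{PSL}_2(\mathbb{R})$ is called semisimple (resp. split semisimple) if it is the image of a semisimple (resp. split semisimple) element of $\mathrm{SL}_2(\mathbb{R})$. *)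

theory Defs
  imports "HOL-Analysis.Analysis" "HOL-Algebra.Algebra"
begin

text \<open>The free group on a set \<open>S\<close>, realised on reduced words. The letter \<open>(x, True)\<close> stands for
  \<open>x\<close> and \<open>(x, False)\<close> for its inverse; multiplication is concatenation followed
  by free cancellation.\<close>

definition flip :: "'a \<times> bool \<Rightarrow> 'a \<times> bool" where
  "flip l = (fst l, \<not> snd l)"

fun reduced_word :: "('a \<times> bool) list \<Rightarrow> bool" where
  "reduced_word (l # m # u) = (m \<noteq> flip l \<and> reduced_word (m # u))"
| "reduced_word _ = True"

fun push :: "'a \<times> bool \<Rightarrow> ('a \<times> bool) list \<Rightarrow> ('a \<times> bool) list" where
  "push l [] = [l]"
| "push l (m # u) = (if m = flip l then u else l # m # u)"

definition free_group :: "'a set \<Rightarrow> ('a \<times> bool) list monoid" where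
  "free_group S = \<lparr>carrier = {u. reduced_word u \<and> fst ` set u \<subseteq> S},
     mult = (\<lambda>u v. foldr push u v), one = []\<rparr>"

fun eval_word :: "('g, 'm) monoid_scheme \<Rightarrow> ('a \<Rightarrow> 'g) \<Rightarrow> ('a \<times> bool) list \<Rightarrow> 'g" where
  "eval_word G g [] = \<one>\<^bsub>G\<^esub>"
| "eval_word G g ((x, b) # u) = (if b then g x else inv\<^bsub>G\<^esub> (g x)) \<otimes>\<^bsub>G\<^esub> eval_word G g u"

definition word_map_image :: "('g, 'm) monoid_scheme \<Rightarrow> nat \<Rightarrow> (nat \<times> bool) list \<Rightarrow> 'g set" where
  "word_map_image G d w = (\<lambda>g. eval_word G g w) ` ({1..d} \<rightarrow>\<^sub>E carrier G)"

lemma flip_flip [simp]: "flip (flip l) = l"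
  by (simp add: flip_def)

lemma reduced_tl: "reduced_word (l # u) \<Longrightarrow> reduced_word u"
  by (cases u) auto

lemma push_reduced: "reduced_word u \<Longrightarrow> reduced_word (push l u)"
  by (cases u) (auto intro: reduced_tl)

lemma push_flip: "reduced_word u \<Longrightarrow> push l (push (flip l) u) = u"
  by (cases u rule: reduced_word.cases) auto

lemma foldr_push_reduced: "reduced_word v \<Longrightarrow> reduced_word (foldr push u v)"
  by (induction u) (auto intro: push_reduced)

lemma foldr_push_assoc:
  assumes "reduced_word v" "reduced_word z"
  shows "foldr push (foldr push u v) z = foldr push u (foldr push v z)"
proof (induction u)
  case (Cons l u)
  have "foldr push (push l t) z = push l (foldr push t z)" for t
  proof (cases t)
    case (Cons m t')
    then show ?thesis
      using push_flip[OF foldr_push_reduced[OF assms(2), of t'], of l] by auto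
  qed auto
  then show ?case using Cons by simp
qed simp

lemma foldr_push_Nil: "reduced_word u \<Longrightarrow> foldr push u [] = u"
proof (induction u)
  case (Cons l u)
  then show ?case using reduced_tl[OF Cons.prems] by (cases u) auto
qed simp

lemma push_letters: "fst ` set (push l u) \<subseteq> insert (fst l) (fst ` set u)"
  by (cases u) auto

lemma foldr_push_letters: "fst ` set (foldr push u v) \<subseteq> fst ` set u \<union> fst ` set v"
proof (induction u)
  case (Cons l u)
  have "fst ` set (foldr push (l # u) v) \<subseteq> insert (fst l) (fst ` set (foldr push u v))"
    using push_letters[of l "foldr push u v"] by simp
  also have "\<dots> \<subseteq> insert (fst l) (fst ` set u \<union> fst ` set v)"
    using Cons by blast
  finally show ?case by simp
qed simp

lemma reduced_snoc: "reduced_word (u @ [l, m]) \<longleftrightarrow> m \<noteq> flip l \<and> reduced_word (u @ [l])"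
  by (induction u rule: reduced_word.induct) auto

lemma reduced_inverse: "reduced_word u \<Longrightarrow> reduced_word (rev (map flip u))"
proof (induction u rule: reduced_word.induct)
  case (1 l m u)
  then show ?case using reduced_snoc[of "rev (map flip u)" "flip m" "flip l"] by auto
qed auto

lemma foldr_push_inverse: "reduced_word v \<Longrightarrow> foldr push (rev (map flip u)) (foldr push u v) = v"
proof (induction u)
  case (Cons l u)
  then show ?case
    using push_flip[OF foldr_push_reduced[OF Cons.prems, of u], of "flip l"] by simp
qed simp

lemma free_group_group: "group (free_group S)"
proof (rule groupI)
  fix u v assume "u \<in> carrier (free_group S)" "v \<in> carrier (free_group S)"
  then show "u \<otimes>\<^bsub>free_group S\<^esub> v \<in> carrier (free_group S)"
    using order_trans[OF foldr_push_letters[of u v], of S]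
    by (simp add: free_group_def foldr_push_reduced)
next
  fix u assume u: "u \<in> carrier (free_group S)"
  have "rev (map flip u) \<in> carrier (free_group S)"
    using u reduced_inverse[of u] by (auto simp: free_group_def flip_def)
  moreover have "rev (map flip u) \<otimes>\<^bsub>free_group S\<^esub> u = \<one>\<^bsub>free_group S\<^esub>"
    using u foldr_push_inverse[of "[]" u] by (simp add: free_group_def foldr_push_Nil)
  ultimately show "\<exists>v\<in>carrier (free_group S). v \<otimes>\<^bsub>free_group S\<^esub> u = \<one>\<^bsub>free_group S\<^esub>"
    by blast
qed (auto simp: free_group_def foldr_push_assoc)

lemma (in group) eval_word_closed:
  assumes "g \<in> S \<rightarrow> carrier G" "fst ` set u \<subseteq> S"
  shows "eval_word G g u \<in> carrier G"
  using assms by (induction u rule: induct_list012) (auto simp: Pi_iff)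

lemma (in group) eval_word_push:
  assumes "g \<in> S \<rightarrow> carrier G" "fst l \<in> S" "fst ` set u \<subseteq> S"
  shows "eval_word G g (push l u) = eval_word G g (l # u)"
proof (cases u)
  case (Cons m u')
  obtain x b where l: "l = (x, b)" by fastforce
  have gx: "g x \<in> carrier G" using assms l by auto
  have "eval_word G g u' \<in> carrier G"
    using assms Cons by (intro eval_word_closed[OF assms(1)]) simp
  then show ?thesis
    using gx by (auto simp: Cons l flip_def m_assoc[symmetric])
qed simp

lemma (in group) eval_word_hom:
  assumes g: "g \<in> S \<rightarrow> carrier G"
  shows "eval_word G g \<in> hom (free_group S) G"
proof (rule homI)
  fix u v assume "u \<in> carrier (free_group S)" "v \<in> carrier (free_group S)"
  then have u: "fst ` set u \<subseteq> S" and v: "fst ` set v \<subseteq> S" by (auto simp: free_group_def)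
  have "eval_word G g (foldr push u v) = eval_word G g u \<otimes> eval_word G g v"
    using u
  proof (induction u)
    case Nil
    then show ?case using eval_word_closed[OF g v] by simp
  next
    case (Cons l u)
    obtain x b where l: "l = (x, b)" by fastforce
    have "g x \<in> carrier G" "fst l \<in> S" using g l Cons.prems by auto
    moreover have "fst ` set (foldr push u v) \<subseteq> S"
      using order_trans[OF foldr_push_letters[of u v], of S] v Cons.prems by simp
    ultimately show ?case
      using Cons eval_word_push[OF g, of l "foldr push u v"]
        eval_word_closed[OF g, of u] eval_word_closed[OF g v]
      by (auto simp: l m_assoc)
  qed
  then show "eval_word G g (u \<otimes>\<^bsub>free_group S\<^esub> v) = eval_word G g u \<otimes> eval_word G g v"
    by (simp add: free_group_def)
qed (auto simp: free_group_def intro!: eval_word_closed[OF g])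

definition SL2R :: "(real ^ 2 ^ 2) monoid" where
  "SL2R = \<lparr>carrier = {A. det A = 1}, mult = (**), one = mat 1\<rparr>"

definition PSL2R :: "(real ^ 2 ^ 2) set monoid" where
  "PSL2R = SL2R Mod {mat 1, - mat 1}"

definition to_PSL2R :: "real ^ 2 ^ 2 \<Rightarrow> (real ^ 2 ^ 2) set" where
  "to_PSL2R A = {mat 1, - mat 1} #>\<^bsub>SL2R\<^esub> A"

definition complexify :: "real ^ 'n ^ 'm \<Rightarrow> complex ^ 'n ^ 'm" where
  "complexify A = (\<chi> i j. complex_of_real (A $ i $ j))"

definition SL2R_semisimple :: "real ^ 2 ^ 2 \<Rightarrow> bool" where
  "SL2R_semisimple A \<longleftrightarrow> A \<in> carrier SL2R \<and>
     (\<exists>P D :: complex ^ 2 ^ 2. invertible P \<and> (\<forall>i j. i \<noteq> j \<longrightarrow> D $ i $ j = 0) \<and>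
        complexify A = P ** D ** matrix_inv P)"

definition SL2R_split_semisimple :: "real ^ 2 ^ 2 \<Rightarrow> bool" where
  "SL2R_split_semisimple A \<longleftrightarrow> A \<in> carrier SL2R \<and>
     (\<exists>P \<in> carrier SL2R. \<exists>\<alpha>. \<alpha> \<noteq> 0 \<and>
        A = P \<otimes>\<^bsub>SL2R\<^esub> vector [vector [\<alpha>, 0], vector [0, inverse \<alpha>]] \<otimes>\<^bsub>SL2R\<^esub> inv\<^bsub>SL2R\<^esub> P)"

definition PSL2R_semisimple :: "(real ^ 2 ^ 2) set \<Rightarrow> bool" where
  "PSL2R_semisimple h \<longleftrightarrow> (\<exists>A. SL2R_semisimple A \<and> h = to_PSL2R A)"

definition PSL2R_split_semisimple :: "(real ^ 2 ^ 2) set \<Rightarrow> bool" where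
  "PSL2R_split_semisimple h \<longleftrightarrow> (\<exists>A. SL2R_split_semisimple A \<and> h = to_PSL2R A)"

lemma SL2R_group: "group SL2R"
proof (rule groupI)
  fix A assume "A \<in> carrier SL2R"
  then have A: "det A = 1" by (simp add: SL2R_def)
  then have "invertible A" by (simp add: invertible_det_nz)
  then obtain B where B: "B ** A = mat 1" by (auto simp: invertible_def)
  then have "det B = 1" using A by (metis det_I det_mul mult.right_neutral)
  with B show "\<exists>B\<in>carrier SL2R. B \<otimes>\<^bsub>SL2R\<^esub> A = \<one>\<^bsub>SL2R\<^esub>" by (auto simp: SL2R_def)
qed (auto simp: SL2R_def det_mul matrix_mul_assoc)

lemma centre_normal: "{mat 1, - mat 1} \<lhd> SL2R"
proof -
  interpret SL2R: group SL2R by (rule SL2R_group)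
  have m: "- mat 1 ** A = - A" "A ** - mat 1 = - A" for A :: "real ^ 2 ^ 2"
    by (simp_all add: vec_eq_iff forall_2 matrix_matrix_mult_def mat_def sum_2)
  have one: "\<one>\<^bsub>SL2R\<^esub> = mat 1" by (simp add: SL2R_def)
  have neg: "- mat 1 \<in> carrier SL2R" by (simp add: SL2R_def det_2 mat_def)
  have "inv\<^bsub>SL2R\<^esub> (- mat 1) = - mat 1"
    by (rule SL2R.inv_equality) (use neg in \<open>auto simp: SL2R_def m\<close>)
  then have "subgroup {mat 1, - mat 1} SL2R"
    using neg SL2R.one_closed SL2R.inv_one unfolding one
    by unfold_locales (auto simp: one, auto simp: SL2R_def m)
  then show ?thesis
    by (rule SL2R.normalI) (auto simp: r_coset_def l_coset_def, auto simp: SL2R_def m)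
qed

lemma PSL2R_group: "group PSL2R"
  unfolding PSL2R_def by (rule normal.factorgroup_is_group[OF centre_normal])

end

theory Submission
  imports Defs
begin

text \<open>On \<open>SL\<^sub>2(\<real>)\<^sup>d\<close>, which is path connected, \<open>g \<mapsto> \<bar>tr w(g)\<bar>\<close> is continuous with value 2 at the
  identity, so its values form an interval. It is unbounded: send the generators to hyperbolic
  matrices with eigenvalues \<open>t, 1/t\<close> and pairwise distinct eigenlines. As \<open>t \<rightarrow> \<infinity>\<close>, the matrix of
  each letter is \<open>t\<close> times a rank-one projection up to lower order, and the trace of the product of
  these projections along a cyclically reduced word does not vanish. An involution in the image
  has trace 0, so in that case every value in \<open>[0, \<infinity>)\<close> occurs. Finally, elements of
  \<open>SL\<^sub>2(\<real>)\<close> with equal trace different from \<open>\<plusminus>2\<close> are conjugate in \<open>GL\<^sub>2(\<real>)\<close>, whose conjugations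
  are automorphisms of \<open>SL\<^sub>2(\<real>)\<close> and hence preserve the image of the word map.\<close>

section \<open>Two-by-two matrices\<close>

lemma mat2_eq_iff:
  fixes A B :: "'a ^ 2 ^ 2"
  shows "A = B \<longleftrightarrow> A$1$1 = B$1$1 \<and> A$1$2 = B$1$2 \<and> A$2$1 = B$2$1 \<and> A$2$2 = B$2$2"
  by (auto simp: vec_eq_iff forall_2)

lemma mat2_mult_nth:
  fixes A B :: "'a::semiring_1 ^ 2 ^ 2"
  shows "(A ** B) $ i $ j = A$i$1 * B$1$j + A$i$2 * B$2$j"
  by (simp add: matrix_matrix_mult_def sum_2)

lemma mat2_mat_nth: "(mat k :: 'a::zero ^ 2 ^ 2) $ i $ j = (if i = j then k else 0)"
  by (simp add: mat_def)

lemma trace_2: "trace (A :: 'a::semiring_1 ^ 2 ^ 2) = A$1$1 + A$2$2"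
  by (simp add: trace_def sum_2)

lemmas mat2_simps = mat2_eq_iff mat2_mult_nth mat2_mat_nth trace_2 det_2

text \<open>The adjugate. On determinant 1 it is the inverse, given by polynomials in the entries,
  so continuity is immediate.\<close>

definition adj2 :: "'a::comm_ring_1 ^ 2 ^ 2 \<Rightarrow> 'a ^ 2 ^ 2" where
  "adj2 A = vector [vector [A$2$2, - A$1$2], vector [- A$2$1, A$1$1]]"

lemma adj2_nth [simp]:
  "adj2 A $ 1 $ 1 = A$2$2" "adj2 A $ 1 $ 2 = - A$1$2"
  "adj2 A $ 2 $ 1 = - A$2$1" "adj2 A $ 2 $ 2 = A$1$1"
  by (simp_all add: adj2_def)

lemma det_adj2 [simp]: "det (adj2 A) = det A"
  by (simp add: det_2 mult.commute)

lemma adj2_mult: "adj2 A ** A = mat (det A)" "A ** adj2 A = mat (det A)"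
  by (auto simp: mat2_simps algebra_simps)

lemma continuous_on_mat2:
  fixes f :: "'a::topological_space \<Rightarrow> real ^ 2 ^ 2"
  assumes "\<And>i j. continuous_on S (\<lambda>x. f x $ i $ j)"
  shows "continuous_on S f"
proof -
  have "continuous_on S (\<lambda>x. \<chi> i j. f x $ i $ j)"
    by (intro continuous_on_vec_lambda assms)
  then show ?thesis by simp
qed

lemma continuous_on_vector2:
  fixes f g :: "'a::topological_space \<Rightarrow> 'b::real_normed_vector"
  assumes "continuous_on S f" "continuous_on S g"
  shows "continuous_on S (\<lambda>x. vector [f x, g x] :: 'b ^ 2)"
proof -
  have "(vector [a, b] :: 'b ^ 2) = (\<chi> i. if i = 1 then a else b)" for a b
    by (simp add: vec_eq_iff forall_2)
  moreover have "continuous_on S (\<lambda>x. \<chi> i :: 2. if i = 1 then f x else g x)"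
  proof (rule continuous_on_vec_lambda)
    show "continuous_on S (\<lambda>x. if i = 1 then f x else g x)" for i :: 2
      using assms by (cases "i = 1") auto
  qed
  ultimately show ?thesis by simp
qed

lemma continuous_on_mat2_mult:
  fixes f g :: "'a::topological_space \<Rightarrow> real ^ 2 ^ 2"
  assumes "continuous_on S f" "continuous_on S g"
  shows "continuous_on S (\<lambda>x. f x ** g x)"
  by (rule continuous_on_mat2, simp only: mat2_mult_nth) (intro continuous_intros assms)

lemma continuous_on_adj2:
  fixes f :: "'a::topological_space \<Rightarrow> real ^ 2 ^ 2"
  assumes "continuous_on S f"
  shows "continuous_on S (\<lambda>x. adj2 (f x))"
  unfolding adj2_def by (intro continuous_on_vector2 continuous_intros assms)

lemma continuous_on_trace2:
  fixes f :: "'a::topological_space \<Rightarrow> real ^ 2 ^ 2"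
  assumes "continuous_on S f"
  shows "continuous_on S (\<lambda>x. trace (f x))"
  unfolding trace_2 by (intro continuous_intros assms)

section \<open>Trace and conjugacy of matrices of determinant 1\<close>

lemma trace_conjugate:
  fixes A :: "real ^ 2 ^ 2"
  assumes "Q ** P = mat 1"
  shows "trace (P ** A ** Q) = trace A"
  by (metis assms matrix_mul_assoc matrix_mul_lid trace_mul_sym)

text \<open>A nonscalar matrix has a vector v that is not an eigenvector. In the basis v, Av it
  becomes a companion matrix, because A(Av) = tr(A) Av - v by Cayley-Hamilton.\<close>

lemma nonscalar_conjugate_companion:
  fixes A :: "'a::field ^ 2 ^ 2"
  assumes "det A = 1" "\<And>k. A \<noteq> mat k"
  obtains P where "det P \<noteq> 0" "A ** P = P ** vector [vector [0, -1], vector [1, trace A]]"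
proof -
  \<comment> \<open>The columns of \<open>K x y\<close> are v = (x, y) and Av, so its determinant
    vanishes iff v is zero or an eigenvector.\<close>
  define K where "K x y = (vector [vector [x, A$1$1 * x + A$1$2 * y], vector [y, A$2$1 * x + A$2$2 * y]]
      :: 'a ^ 2 ^ 2)" for x y
  have K: "A ** K x y = K x y ** vector [vector [0, -1], vector [1, trace A]]" for x y
  proof -
    have "A$1$2 * A$2$1 = A$1$1 * A$2$2 - 1"
      using assms(1) by (simp add: det_2 algebra_simps)
    then have "z * (A$1$2 * A$2$1) = z * (A$1$1 * A$2$2 - 1)" for z
      by simp
    from this[of x] this[of y] show ?thesis
      unfolding K_def by (simp add: mat2_simps algebra_simps)
  qed
  have "\<exists>x y. det (K x y) \<noteq> 0"
  proof (rule ccontr)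
    assume *: "\<not> ?thesis"
    \<comment> \<open>If both basis vectors and their sum are eigenvectors, the matrix is
      scalar.\<close>
    have "det (K 1 0) = 0" "det (K 0 1) = 0" "det (K 1 1) = 0" using * by blast+
    then have "A = mat (A$1$1)"
      by (auto simp: K_def mat2_simps)
    then show False using assms(2) by blast
  qed
  then show ?thesis using K that by blast
qed

text \<open>Both matrices are conjugate to the companion matrix \<open>C\<close>, which depends on
  the trace only. Over the reals the conjugator cannot always have determinant 1: opposite rotations
  are conjugate in GL2 but in general not in SL2.\<close>

lemma conjugate_of_trace_eq:
  fixes A B :: "'a::field ^ 2 ^ 2"
  assumes "det A = 1" "\<And>k. A \<noteq> mat k" "det B = 1" "\<And>k. B \<noteq> mat k" "trace A = trace B"
  obtains P Q where "P ** Q = mat 1" "Q ** P = mat 1" "A = P ** B ** Q"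
proof -
  define C :: "'a ^ 2 ^ 2" where "C = vector [vector [0, -1], vector [1, trace A]]"
  obtain P where P: "det P \<noteq> 0" "A ** P = P ** C"
    using nonscalar_conjugate_companion[OF assms(1,2)] C_def by metis
  obtain R where R: "det R \<noteq> 0" "B ** R = R ** C"
    using nonscalar_conjugate_companion[OF assms(3,4)] C_def assms(5) by metis
  obtain P' where P': "P ** P' = mat 1" "P' ** P = mat 1"
    using P(1) by (meson invertible_def invertible_det_nz)
  obtain R' where R': "R ** R' = mat 1" "R' ** R = mat 1"
    using R(1) by (meson invertible_def invertible_det_nz)
  show ?thesis
  proof
    show "(P ** R') ** (R ** P') = mat 1" "(R ** P') ** (P ** R') = mat 1"
      using P' R' by (metis matrix_mul_assoc matrix_mul_rid)+
    have "A = A ** P ** P'" using P' by (metis matrix_mul_assoc matrix_mul_rid)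
    also have "\<dots> = P ** (R' ** R) ** C ** P'" using P(2) R' by simp
    also have "\<dots> = P ** R' ** (R ** C) ** P'" by (simp add: matrix_mul_assoc)
    also have "\<dots> = (P ** R') ** B ** (R ** P')" by (simp add: R(2)[symmetric] matrix_mul_assoc)
    finally show "A = (P ** R') ** B ** (R ** P')" .
  qed
qed

section \<open>The groups and their word maps\<close>

lemma SL2R_simps:
  "carrier SL2R = {A. det A = 1}" "A \<otimes>\<^bsub>SL2R\<^esub> B = A ** B" "\<one>\<^bsub>SL2R\<^esub> = mat 1"
  by (simp_all add: SL2R_def)

lemma inv_SL2R:
  assumes "det A = 1"
  shows "inv\<^bsub>SL2R\<^esub> A = adj2 A"
proof -
  interpret group SL2R by (rule SL2R_group)
  show ?thesis
    by (rule inv_equality) (use assms in \<open>simp_all add: SL2R_simps adj2_mult\<close>)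
qed

lemma neg_mat1_mult: "- mat 1 ** A = - A" for A :: "real ^ 2 ^ 2"
  by (simp add: mat2_simps)

lemma to_PSL2R_eq: "to_PSL2R A = {A, - A}"
  by (auto simp: to_PSL2R_def r_coset_def SL2R_simps neg_mat1_mult)

lemma to_PSL2R_uminus: "to_PSL2R (- A) = to_PSL2R A"
  by (auto simp: to_PSL2R_eq)

lemma to_PSL2R_eq_iff: "to_PSL2R A = to_PSL2R B \<longleftrightarrow> A = B \<or> A = - B"
  by (auto simp: to_PSL2R_eq doubleton_eq_iff)

lemma one_PSL2R: "\<one>\<^bsub>PSL2R\<^esub> = to_PSL2R (mat 1)"
  by (auto simp: PSL2R_def FactGroup_def to_PSL2R_eq)

lemma carrier_PSL2R: "carrier PSL2R = to_PSL2R ` carrier SL2R"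
  by (auto simp: PSL2R_def FactGroup_def RCOSETS_def to_PSL2R_def)

lemma to_PSL2R_group_hom: "group_hom SL2R PSL2R to_PSL2R"
proof -
  have "to_PSL2R \<in> hom SL2R PSL2R"
    using normal.r_coset_hom_Mod[OF centre_normal]
    by (simp add: PSL2R_def to_PSL2R_def[abs_def])
  then show ?thesis
    by (simp add: group_hom_def group_hom_axioms_def SL2R_group PSL2R_group)
qed

lemma (in group_hom) eval_word_comp:
  assumes "g \<in> S \<rightarrow> carrier G" "fst ` set u \<subseteq> S"
  shows "eval_word H (\<lambda>x. h (g x)) u = h (eval_word G g u)"
  using assms(2)
proof (induction u)
  case (Cons l u)
  have "g (fst l) \<in> carrier G" "eval_word G g u \<in> carrier G"
    using Cons.prems assms(1) G.eval_word_closed[OF assms(1), of u] by auto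
  with Cons show ?case by (cases l) auto
qed simp

lemma eval_word_cong:
  assumes "\<And>x. x \<in> fst ` set u \<Longrightarrow> g x = g' x"
  shows "eval_word G g u = eval_word G g' u"
  using assms by (induction G g u rule: eval_word.induct) auto

text \<open>Every tuple in PSL2 lifts to SL2 and the projection is a homomorphism, so real matrices
  can be used from here on. The tuples are total functions, since \<open>w\<close> sees only their
  values on \<open>{1..d}\<close>.\<close>

lemma word_map_image_PSL2R:
  assumes "fst ` set w \<subseteq> {1..d}"
  shows "word_map_image PSL2R d w
    = (\<lambda>g. to_PSL2R (eval_word SL2R g w)) ` {g. \<forall>x. det (g x) = 1}"
proof -
  interpret group_hom SL2R PSL2R to_PSL2R by (rule to_PSL2R_group_hom)
  have "h \<in> word_map_image PSL2R d w" if g: "\<forall>x. det (g x) = 1"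
    and h: "h = to_PSL2R (eval_word SL2R g w)" for h g
  proof -
    have *: "g \<in> UNIV \<rightarrow> carrier SL2R" using g by (auto simp: SL2R_simps)
    have "h = eval_word PSL2R (\<lambda>x. to_PSL2R (g x)) w"
      using eval_word_comp[OF *, of w] h by simp
    also have "\<dots> = eval_word PSL2R (restrict (\<lambda>x. to_PSL2R (g x)) {1..d}) w"
      using assms by (intro eval_word_cong) auto
    finally show ?thesis
      using * unfolding word_map_image_def carrier_PSL2R
      by (intro image_eqI[where x = "restrict (\<lambda>x. to_PSL2R (g x)) {1..d}"]) auto
  qed
  moreover have "\<exists>g. (\<forall>x. det (g x) = 1) \<and> h = to_PSL2R (eval_word SL2R g w)"
    if "h \<in> word_map_image PSL2R d w" for h
  proof -
    from that[unfolded word_map_image_def]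
    obtain k where k: "h = eval_word PSL2R k w" "k \<in> {1..d} \<rightarrow>\<^sub>E carrier PSL2R"
      by (rule imageE)
    have "\<forall>x\<in>{1..d}. \<exists>A. det A = 1 \<and> k x = to_PSL2R A"
      using k(2) by (fastforce simp: carrier_PSL2R SL2R_simps)
    then obtain g where g: "\<And>x. x \<in> {1..d} \<Longrightarrow> det (g x) = 1 \<and> k x = to_PSL2R (g x)"
      by metis
    \<comment> \<open>The identity outside \<open>{1..d}\<close> makes the determinant 1 at every
      index.\<close>
    define g' where "g' x = (if x \<in> {1..d} then g x else mat 1)" for x
    have g': "\<forall>x. det (g' x) = 1" using g by (simp add: g'_def)
    then have *: "g' \<in> UNIV \<rightarrow> carrier SL2R" by (auto simp: SL2R_simps)
    have "h = eval_word PSL2R (\<lambda>x. to_PSL2R (g' x)) w"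
      unfolding k(1) using assms g by (intro eval_word_cong) (auto simp: g'_def)
    then show ?thesis using eval_word_comp[OF *, of w] g' by auto
  qed
  ultimately show ?thesis by blast
qed

text \<open>Conjugation by any invertible matrix preserves determinants, hence is an automorphism of
  SL2 even when \<open>P\<close> lies outside SL2.\<close>

lemma eval_word_conjugate:
  fixes P Q :: "real ^ 2 ^ 2"
  assumes PQ: "P ** Q = mat 1" "Q ** P = mat 1" and g: "\<And>x. det (g x) = 1"
  shows "eval_word SL2R (\<lambda>x. P ** g x ** Q) w = P ** eval_word SL2R g w ** Q"
proof -
  have det: "det P * det Q = 1" using PQ(1) by (metis det_I det_mul)
  have "P ** (A ** B) ** Q = P ** A ** Q ** (P ** B ** Q)" for A B
    by (metis PQ(2) matrix_mul_assoc matrix_mul_rid)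
  then have "(\<lambda>A. P ** A ** Q) \<in> hom SL2R SL2R"
    using det by (auto simp: hom_def SL2R_simps det_mul)
  then interpret group_hom SL2R SL2R "\<lambda>A. P ** A ** Q"
    by (simp add: group_hom_def group_hom_axioms_def SL2R_group)
  show ?thesis
    using g by (intro eval_word_comp[where S = UNIV]) (auto simp: SL2R_simps)
qed

lemma eval_word_SL2R_one: "eval_word SL2R (\<lambda>x. mat 1) w = mat 1"
proof -
  interpret group SL2R by (rule SL2R_group)
  have "eval_word SL2R (\<lambda>x. \<one>\<^bsub>SL2R\<^esub>) w = \<one>\<^bsub>SL2R\<^esub>"
    by (induction w) auto
  then show ?thesis by (simp add: SL2R_simps)
qed

text \<open>Each letter, inverse letters included, has its own matrix, so singular matrices such as
  projections are allowed.\<close>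

definition word_prod :: "('l \<Rightarrow> real ^ 2 ^ 2) \<Rightarrow> 'l list \<Rightarrow> real ^ 2 ^ 2" where
  "word_prod f w = foldr (\<lambda>l B. f l ** B) w (mat 1)"

lemma word_prod_simps [simp]:
  "word_prod f [] = mat 1" "word_prod f (l # w) = f l ** word_prod f w"
  by (simp_all add: word_prod_def)

lemma word_prod_append: "word_prod f (u @ v) = word_prod f u ** word_prod f v"
  by (induction u) (simp_all add: matrix_mul_assoc)

lemma det_word_prod: "(\<And>l. det (f l) = 1) \<Longrightarrow> det (word_prod f w) = 1"
  by (induction w) (simp_all add: det_mul)

lemma word_prod_scaleR: "word_prod (\<lambda>l. c *\<^sub>R f l) w = c ^ length w *\<^sub>R word_prod f w"
  by (induction w) (auto simp: mat2_simps algebra_simps)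

lemma continuous_on_word_prod:
  assumes "\<And>l. continuous_on S (\<lambda>t. f t l)"
  shows "continuous_on S (\<lambda>t. word_prod (f t) w)"
  by (induction w) (auto intro: continuous_on_mat2_mult assms)

lemma eval_word_SL2R:
  assumes "\<And>x. det (g x) = 1"
  shows "eval_word SL2R g w = word_prod (\<lambda>(x, b). if b then g x else adj2 (g x)) w"
  using assms by (induction w) (auto simp: SL2R_simps inv_SL2R)

lemma det_eval_word:
  assumes "\<And>x. det (g x) = 1"
  shows "det (eval_word SL2R g w) = 1"
  unfolding eval_word_SL2R[OF assms] using assms by (intro det_word_prod) auto

section \<open>Traces of word values form an interval\<close>

text \<open>A matrix of determinant 1 is a product of elementary matrices; multiplying all their
  parameters by t joins it to the identity.\<close>

lemma SL2R_path:
  fixes A :: "real ^ 2 ^ 2"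
  assumes "det A = 1"
  obtains p where "continuous_on UNIV p" "p 0 = mat 1" "p (1::real) = A" "\<And>t. det (p t) = 1"
proof -
  define U :: "real \<Rightarrow> real ^ 2 ^ 2" where "U s = vector [vector [1, s], vector [0, 1]]" for s
  define L :: "real \<Rightarrow> real ^ 2 ^ 2" where "L s = vector [vector [1, 0], vector [s, 1]]" for s
  have UL: "\<exists>x y z. B = U x ** L y ** U z" if "det B = 1" "B$2$1 \<noteq> 0" for B
  proof (intro exI)
    show "B = U ((B$1$1 - 1) / B$2$1) ** L (B$2$1) ** U ((B$2$2 - 1) / B$2$1)"
      using that by (auto simp: U_def L_def mat2_simps field_simps)
  qed
  have "\<exists>v x y z. A = L v ** U x ** L y ** U z"
  proof (cases "A$2$1 = 0")
    case True
    have "A$1$1 \<noteq> 0" using assms True by (auto simp: det_2)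
    \<comment> \<open>Adding the first row to the second turns the lower left entry 0 into the
      nonzero entry \<open>A$1$1\<close>.\<close>
    then obtain x y z where "L 1 ** A = U x ** L y ** U z"
      using UL[of "L 1 ** A"] assms True by (auto simp: det_mul mat2_mult_nth) (auto simp: L_def det_2)
    then have "L (-1) ** (L 1 ** A) = L (-1) ** U x ** L y ** U z"
      by (simp add: matrix_mul_assoc)
    moreover have "L (-1) ** (L 1 ** A) = A" by (simp add: L_def mat2_simps)
    ultimately show ?thesis by metis
  next
    case False
    have "L 0 = mat 1" by (simp add: L_def mat2_simps)
    with UL[OF assms False] show ?thesis by (metis matrix_mul_lid)
  qed
  then obtain v x y z where A: "A = L v ** U x ** L y ** U z" by blast
  have cont: "continuous_on UNIV (\<lambda>t. U (t * s))" "continuous_on UNIV (\<lambda>t. L (t * s))" for s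
    unfolding U_def L_def by (intro continuous_on_vector2 continuous_intros)+
  show ?thesis
  proof
    show "continuous_on UNIV (\<lambda>t. L (t * v) ** U (t * x) ** L (t * y) ** U (t * z))"
      by (intro continuous_on_mat2_mult cont)
    show "det (L (t * v) ** U (t * x) ** L (t * y) ** U (t * z)) = 1" for t
      unfolding det_mul by (simp add: U_def L_def det_2)
  qed (simp_all add: A, simp_all add: U_def L_def mat2_simps)
qed

text \<open>Moving all generators simultaneously from the identity to \<open>g\<close> gives a
  continuous absolute trace starting at 2. A segment is used since the end value may lie on either
  side of 2.\<close>

lemma word_trace_IVT:
  fixes g :: "'a \<Rightarrow> real ^ 2 ^ 2"
  assumes g: "\<And>x. det (g x) = 1"
    and c: "c \<in> closed_segment 2 \<bar>trace (eval_word SL2R g w)\<bar>"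
  obtains g' where "\<And>x. det (g' x) = 1" "\<bar>trace (eval_word SL2R g' w)\<bar> = c"
proof -
  have "\<forall>x. \<exists>p. continuous_on UNIV p \<and> p (0::real) = mat 1 \<and> p 1 = g x \<and> (\<forall>t. det (p t) = 1)"
    using SL2R_path[OF g] by metis
  then obtain p where p: "\<And>x. continuous_on UNIV (p x)" "\<And>x. p x (0::real) = mat 1"
    "\<And>x. p x 1 = g x" "\<And>x t. det (p x t) = 1"
    by metis
  define F where "F t = \<bar>trace (eval_word SL2R (\<lambda>x. p x t) w)\<bar>" for t
  have cont: "continuous_on UNIV F"
    unfolding F_def eval_word_SL2R[OF p(4)]
  proof (intro continuous_on_rabs continuous_on_trace2 continuous_on_word_prod)
    show "continuous_on UNIV (\<lambda>t. case l of (x, b) \<Rightarrow> if b then p x t else adj2 (p x t))" for l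
      using p(1) continuous_on_adj2[OF p(1)] by (cases l; cases "snd l") auto
  qed
  have "F 0 = 2" by (simp add: F_def p(2) eval_word_SL2R_one trace_2 mat2_mat_nth)
  moreover have "F 1 = \<bar>trace (eval_word SL2R g w)\<bar>" by (simp add: F_def p(3))
  ultimately have "c \<in> closed_segment (F 0) (F 1)" using c by simp
  moreover have "connected (range F)"
    by (intro connected_continuous_image cont connected_UNIV)
  then have "convex (range F)"
    by (simp add: is_interval_connected_1 flip: is_interval_convex_1)
  then have "closed_segment (F 0) (F 1) \<subseteq> range F"
    by (intro closed_segment_subset) auto
  ultimately obtain t where "F t = c"
    by blast
  then show ?thesis using that[of "\<lambda>x. p x t"] p(4) by (simp add: F_def)
qed


section \<open>Unboundedness of the trace\<close>

text \<open>The letter \<open>l\<close> will act with attracting eigenline of slope \<open>slope l\<close>; the repelling one is that of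
  \<open>flip l\<close>. Consecutive integers make the eigenprojections integral.\<close>

definition slope :: "nat \<times> bool \<Rightarrow> real" where
  "slope l = (if snd l then 2 * real (fst l) else 2 * real (fst l) + 1)"

lemma slope_eq_iff: "slope l = slope m \<longleftrightarrow> l = m"
proof -
  have *: "slope l = real (if snd l then 2 * fst l else 2 * fst l + 1)" for l
    by (simp add: slope_def)
  have "slope l = slope m \<longleftrightarrow>
      (if snd l then 2 * fst l else 2 * fst l + 1) = (if snd m then 2 * fst m else 2 * fst m + 1)"
    unfolding * of_nat_eq_iff ..
  also have "\<dots> \<longleftrightarrow> l = m"
    by (cases l; cases m; auto; presburger)
  finally show ?thesis .
qed

text \<open>Image spanned by \<open>(1, a)\<close>, kernel spanned by \<open>(1, b)\<close>.\<close>

definition rank1 :: "real \<Rightarrow> real \<Rightarrow> real ^ 2 ^ 2" where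
  "rank1 a b = vector [vector [b, -1], vector [a * b, - a]]"

text \<open>The factor \<open>b - c\<close> vanishes exactly when the image of the second matrix is
  the kernel of the first.\<close>

lemma rank1_mult: "(x *\<^sub>R rank1 a b) ** (y *\<^sub>R rank1 c e) = (x * y * (b - c)) *\<^sub>R rank1 a e"
  by (simp add: rank1_def mat2_simps algebra_simps)

text \<open>The projection onto the line of slope \<open>slope l\<close> along that of slope
  \<open>slope (flip l)\<close>. The scalar is 1 or -1 and makes the trace 1.\<close>

definition letter_proj :: "nat \<times> bool \<Rightarrow> real ^ 2 ^ 2" where
  "letter_proj l = (slope (flip l) - slope l) *\<^sub>R rank1 (slope l) (slope (flip l))"

lemma slope_flip_diff: "slope (flip l) - slope l = (if snd l then 1 else -1)"
  by (simp add: slope_def flip_def)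

text \<open>Each pair of neighbours l, m contributes the factor
  \<open>slope (flip l) - slope m\<close>, nonzero because the word is reduced and slopes are
  injective.\<close>

lemma word_prod_letter_proj:
  assumes "reduced_word w" "w \<noteq> []"
  obtains K where "K \<noteq> 0"
    "word_prod letter_proj w = K *\<^sub>R rank1 (slope (hd w)) (slope (flip (last w)))"
proof -
  have "\<exists>K. K \<noteq> 0 \<and> word_prod letter_proj w = K *\<^sub>R rank1 (slope (hd w)) (slope (flip (last w)))"
    using assms
  proof (induction w rule: reduced_word.induct)
    case (1 l m u)
    then obtain K where K: "K \<noteq> 0" "word_prod letter_proj (m # u)
        = K *\<^sub>R rank1 (slope m) (slope (flip (last (m # u))))"
      by auto
    have ne: "slope (flip l) - slope m \<noteq> 0" "slope (flip l) - slope l \<noteq> 0"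
      using "1.prems" by (auto simp: slope_eq_iff slope_flip_diff)
    have "word_prod letter_proj (l # m # u) = letter_proj l ** word_prod letter_proj (m # u)"
      by simp
    also have "\<dots> = ((slope (flip l) - slope l) * K * (slope (flip l) - slope m)) *\<^sub>R
        rank1 (slope l) (slope (flip (last (m # u))))"
      unfolding K(2) letter_proj_def
      by (simp add: rank1_mult)
    finally show ?case using K(1) ne
      by (intro exI[of _ "(slope (flip l) - slope l) * K * (slope (flip l) - slope m)"]) simp
  next
    case ("2_2" l)
    then show ?case
      by (auto simp: letter_proj_def slope_flip_diff intro!: exI[of _ "slope (flip l) - slope l"])
  qed simp
  then show ?thesis using that by blast
qed

lemma reduced_word_append_left: "reduced_word (u @ v) \<Longrightarrow> reduced_word u"
  by (induction u rule: reduced_word.induct) auto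

text \<open>The two projections are complementary, so the eigenvalues are t and 1/t, and passing to
  \<open>flip l\<close> exchanges them, that is, inverts the matrix.\<close>

definition hyp :: "real \<Rightarrow> nat \<times> bool \<Rightarrow> real ^ 2 ^ 2" where
  "hyp t l = t *\<^sub>R letter_proj l + inverse t *\<^sub>R letter_proj (flip l)"

lemma det_hyp: "t \<noteq> 0 \<Longrightarrow> det (hyp t l) = 1"
  by (cases l; cases "snd l")
    (simp_all add: hyp_def letter_proj_def slope_def flip_def rank1_def det_2 field_simps)

lemma adj2_hyp: "adj2 (hyp t (x, True)) = hyp t (x, False)"
  by (simp add: hyp_def letter_proj_def slope_def flip_def rank1_def mat2_simps algebra_simps)

lemma eval_word_hyp:
  assumes "t \<noteq> 0"
  shows "eval_word SL2R (\<lambda>x. hyp t (x, True)) w = word_prod (hyp t) w"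
proof -
  have "(\<lambda>(x, b). if b then hyp t (x, True) else adj2 (hyp t (x, True))) = hyp t"
    by (auto simp: fun_eq_iff adj2_hyp)
  then show ?thesis using eval_word_SL2R[of "\<lambda>x. hyp t (x, True)" w] det_hyp[OF assms] by simp
qed

text \<open>Stripping mutually inverse end letters is a conjugation and keeps the trace, which
  reduces by induction on length to cyclically reduced words. There the coefficient of the top power
  of t is nonzero.\<close>

lemma trace_word_hyp_at_top:
  fixes w :: "(nat \<times> bool) list"
  assumes "reduced_word w" "w \<noteq> []"
  shows "filterlim (\<lambda>t. \<bar>trace (word_prod (hyp t) w)\<bar>) at_top at_top"
  using assms
proof (induction "length w" arbitrary: w rule: less_induct)
  case less
  show ?case
  proof (cases "hd w = flip (last w)")
    case True
    then obtain u l where w: "w = flip l # u @ [l]"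
    proof -
      obtain m u where mu: "w = m # u" using less.prems by (cases w) auto
      then have "u \<noteq> []" using True by (auto simp: flip_def prod_eq_iff)
      then show thesis using that[of "last u" "butlast u"] True mu by simp
    qed
    \<comment> \<open>An empty middle would leave \<open>[flip l, l]\<close>, which is not
      reduced.\<close>
    have u: "reduced_word u" "u \<noteq> []"
      using less.prems(1) reduced_word_append_left[of u "[l]"] reduced_tl[of "flip l" "u @ [l]"]
      by (auto simp: w)
    have "trace (word_prod (hyp t) w) = trace (word_prod (hyp t) u)" if "t \<noteq> 0" for t
    proof -
      have "hyp t l ** hyp t (flip l) = mat 1"
        using adj2_mult[of "hyp t (fst l, True)"] det_hyp[OF that] adj2_hyp[of t]
        by (cases l; cases "snd l") (auto simp: flip_def)
      then show ?thesis
        by (simp add: w word_prod_append matrix_mul_assoc trace_conjugate)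
    qed
    then have ev: "\<forall>\<^sub>F t in at_top.
        \<bar>trace (word_prod (hyp t) u)\<bar> = \<bar>trace (word_prod (hyp t) w)\<bar>"
      by (intro eventually_mono[OF eventually_gt_at_top[of 0]]) simp
    show ?thesis
      using less.hyps[of u] u filterlim_cong[OF refl refl ev] by (simp add: w)
  next
    case False
    define n where "n = length w"
    have n: "n > 0" using less.prems by (simp add: n_def)
    \<comment> \<open>With s = 1/t^2, pulling a factor t out of each letter gives the trace as t^n
      F(s). This \<open>F\<close> is continuous up to s = 0, where only the projections
      remain.\<close>
    define F where "F s = trace (word_prod (\<lambda>l. letter_proj l + s *\<^sub>R letter_proj (flip l)) w)" for s
    obtain K where K: "K \<noteq> 0"
      "word_prod letter_proj w = K *\<^sub>R rank1 (slope (hd w)) (slope (flip (last w)))"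
      using word_prod_letter_proj[OF less.prems] by metis
    have "F 0 = K * (slope (flip (last w)) - slope (hd w))"
      by (simp add: F_def K(2) rank1_def trace_2 algebra_simps)
    \<comment> \<open>Cyclic reducedness enters here: \<open>slope (hd w)\<close> differs from
      \<open>slope (flip (last w))\<close>.\<close>
    then have F0: "F 0 \<noteq> 0"
      using K(1) False by (auto simp: slope_eq_iff)
    have "continuous_on UNIV F"
      unfolding F_def
      by (intro continuous_on_trace2 continuous_on_word_prod continuous_intros)
    then have "isCont F 0" by (simp add: continuous_on_eq_continuous_at)
    moreover have "((\<lambda>t::real. inverse t ^ 2) \<longlongrightarrow> 0) at_top"
      using tendsto_power[OF tendsto_inverse_0_at_top[OF filterlim_ident], of 2] by simp
    ultimately have "((\<lambda>t. F (inverse t ^ 2)) \<longlongrightarrow> F 0) at_top"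
      by (rule isCont_tendsto_compose)
    then have "((\<lambda>t. \<bar>F (inverse t ^ 2)\<bar>) \<longlongrightarrow> \<bar>F 0\<bar>) at_top"
      by (rule tendsto_rabs)
    moreover have "filterlim (\<lambda>t::real. t ^ n) at_top at_top"
      using n by (intro filterlim_pow_at_top filterlim_ident)
    ultimately have lim: "filterlim (\<lambda>t. \<bar>F (inverse t ^ 2)\<bar> * t ^ n) at_top at_top"
      using F0 by (intro filterlim_tendsto_pos_mult_at_top) auto
    have "\<bar>F (inverse t ^ 2)\<bar> * t ^ n = \<bar>trace (word_prod (hyp t) w)\<bar>" if "t > 0" for t
    proof -
      have "hyp t = (\<lambda>l. t *\<^sub>R (letter_proj l + inverse t ^ 2 *\<^sub>R letter_proj (flip l)))"
        using that by (auto simp: hyp_def fun_eq_iff scaleR_add_right power2_eq_square)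
      then have "trace (word_prod (hyp t) w) = t ^ n * F (inverse t ^ 2)"
        by (simp only: word_prod_scaleR F_def n_def) (simp add: trace_2 distrib_left)
      then show ?thesis using that by (simp add: abs_mult)
    qed
    then have ev: "\<forall>\<^sub>F t in at_top.
        \<bar>F (inverse t ^ 2)\<bar> * t ^ n = \<bar>trace (word_prod (hyp t) w)\<bar>"
      by (intro eventually_mono[OF eventually_gt_at_top[of 0]]) simp
    show ?thesis by (rule iffD1[OF filterlim_cong[OF refl refl ev] lim])
  qed
qed

lemma word_trace_unbounded:
  fixes w :: "(nat \<times> bool) list"
  assumes "reduced_word w" "w \<noteq> []"
  obtains g where "\<And>x. det (g x) = 1" "\<bar>trace (eval_word SL2R g w)\<bar> \<ge> c"
proof -
  have "\<forall>\<^sub>F t in at_top. \<bar>trace (word_prod (hyp t) w)\<bar> \<ge> c"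
    using trace_word_hyp_at_top[OF assms] by (simp add: filterlim_at_top)
  then have "\<forall>\<^sub>F t in at_top. \<bar>trace (word_prod (hyp t) w)\<bar> \<ge> c \<and> t > 0"
    using eventually_gt_at_top by (rule eventually_conj)
  then obtain t where "\<bar>trace (word_prod (hyp t) w)\<bar> \<ge> c" "t > 0"
    using eventually_happens'[OF trivial_limit_at_top_linorder] by blast
  then show ?thesis
    using that[of "\<lambda>x. hyp t (x, True)"] by (simp add: det_hyp eval_word_hyp)
qed

section \<open>Elements with given trace\<close>

lemma split_semisimple_trace:
  assumes "SL2R_split_semisimple A"
  shows "\<bar>trace A\<bar> \<ge> 2" "\<bar>trace A\<bar> = 2 \<Longrightarrow> to_PSL2R A = to_PSL2R (mat 1)"
proof -
  obtain P \<alpha> where P: "det P = 1" "\<alpha> \<noteq> 0"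
    and A: "A = P ** vector [vector [\<alpha>, 0], vector [0, inverse \<alpha>]] ** adj2 P"
    using assms by (auto simp: SL2R_split_semisimple_def SL2R_simps inv_SL2R)
  have tr: "trace A = \<alpha> + inverse \<alpha>"
    unfolding A using P(1) by (subst trace_conjugate) (simp_all add: adj2_mult trace_2)
  \<comment> \<open>This identity yields both the bound and the equality case \<alpha> =
    1/\<alpha>.\<close>
  have sq: "(\<alpha> + inverse \<alpha>)\<^sup>2 = 2\<^sup>2 + (\<alpha> - inverse \<alpha>)\<^sup>2"
    using P(2) by (simp add: power2_eq_square field_simps)
  then have "2\<^sup>2 \<le> (trace A)\<^sup>2" unfolding tr by simp
  then show "\<bar>trace A\<bar> \<ge> 2" using abs_le_square_iff[of 2 "trace A"] by simp
  assume "\<bar>trace A\<bar> = 2"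
  then have "(trace A)\<^sup>2 = 2\<^sup>2" by (metis power2_abs)
  then have "\<alpha> = inverse \<alpha>" using sq unfolding tr by simp
  then have "\<alpha> = 1 \<or> \<alpha> = -1"
    using P(2) by (metis power2_eq_1_iff power2_eq_square right_inverse)
  moreover have "vector [vector [\<alpha>, 0], vector [0, inverse \<alpha>]] = (mat \<alpha> :: real ^ 2 ^ 2)"
    using \<open>\<alpha> = inverse \<alpha>\<close> by (simp add: mat2_simps)
  ultimately have "A = mat 1 \<or> A = - mat 1"
    using A P(1) by (auto simp: mat2_simps algebra_simps)
  then show "to_PSL2R A = to_PSL2R (mat 1)" by (simp add: to_PSL2R_eq_iff)
qed

text \<open>The eigenvalues have product 1 and sum 2 or -2, hence coincide. A diagonalizable matrix
  with a single eigenvalue is scalar, which excludes nontrivial unipotents.\<close>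

lemma semisimple_trace_2:
  assumes "SL2R_semisimple A" "\<bar>trace A\<bar> = 2"
  shows "to_PSL2R A = to_PSL2R (mat 1)"
proof -
  obtain P D :: "complex ^ 2 ^ 2" where PD: "invertible P" "\<And>i j. i \<noteq> j \<Longrightarrow> D $ i $ j = 0"
    "complexify A = P ** D ** matrix_inv P" and A: "det A = 1"
    using assms(1) by (auto simp: SL2R_semisimple_def SL2R_simps)
  define Q where "Q = matrix_inv P"
  have Q: "P ** Q = mat 1" "Q ** P = mat 1"
    using someI_ex[OF PD(1)[unfolded invertible_def]] by (simp_all add: Q_def matrix_inv_def)
  have D: "D = Q ** complexify A ** P"
    unfolding PD(3) Q_def[symmetric] using Q
    by (metis matrix_mul_assoc matrix_mul_lid matrix_mul_rid)
  obtain e :: real where e: "trace A = 2 * e" "e = 1 \<or> e = -1"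
    using assms(2) by (cases "trace A \<ge> 0") (auto intro: that[of 1] that[of "-1"])
  have "det P * det Q = 1" using Q(1) by (metis det_I det_mul)
  moreover have "det (complexify A) = 1"
    using A by (simp add: complexify_def det_2) (metis of_real_1 of_real_diff of_real_mult)
  ultimately have "det D = 1"
    by (simp add: D det_mul mult.commute)
  then have det: "D$1$1 * D$2$2 = 1"
    using PD(2) by (simp add: det_2)
  have "trace D = trace (complexify A)"
    unfolding D using Q(1) by (metis matrix_mul_assoc matrix_mul_lid trace_mul_sym)
  also have "\<dots> = of_real (2 * e)"
    unfolding e(1)[symmetric] by (simp add: trace_2 complexify_def)
  finally have tr: "D$1$1 + D$2$2 = 2 * of_real e" by (simp add: trace_2)
  \<comment> \<open>The discriminant of the characteristic polynomial, here 4 - 4.\<close>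
  have "(D$1$1 - D$2$2)\<^sup>2 = (D$1$1 + D$2$2)\<^sup>2 - 4 * (D$1$1 * D$2$2)"
    by (simp add: power2_eq_square algebra_simps)
  also have "\<dots> = 0"
    unfolding det tr using e(2) by auto
  finally have "D$1$1 = D$2$2" by simp
  then have "D = mat (of_real e)"
    using tr PD(2) by (simp add: mat2_simps)
  moreover have "P ** mat (of_real e) = mat (of_real e) ** P"
    by (simp add: mat2_simps mult.commute)
  ultimately have "complexify A = mat (of_real e)"
    using Q(1) unfolding PD(3) Q_def[symmetric] by (simp flip: matrix_mul_assoc)
  then have "A = mat e" by (auto simp: mat2_simps complexify_def)
  then show ?thesis
    using e(2) by (auto simp: to_PSL2R_eq_iff mat2_simps)
qed

text \<open>The square of \<open>A\<close> is 1 or -1, so by Cayley-Hamilton tr(A) A is scalar. With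
  nonzero trace, \<open>A\<close> itself would be 1 or -1 and its image trivial.\<close>

lemma involution_trace:
  assumes A: "det A = 1" and ord: "group.ord PSL2R (to_PSL2R A) = 2"
  shows "trace A = 0"
proof -
  interpret group_hom SL2R PSL2R to_PSL2R by (rule to_PSL2R_group_hom)
  have mem: "A \<in> carrier SL2R" using A by (simp add: SL2R_simps)
  have "to_PSL2R A [^]\<^bsub>PSL2R\<^esub> (2::nat) = \<one>\<^bsub>PSL2R\<^esub>"
    using mem H.pow_ord_eq_1[of "to_PSL2R A"] ord by simp
  then have "to_PSL2R A \<otimes>\<^bsub>PSL2R\<^esub> to_PSL2R A = \<one>\<^bsub>PSL2R\<^esub>"
    using mem by (simp add: numeral_2_eq_2)
  then have "to_PSL2R (A ** A) = to_PSL2R (mat 1)"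
    using mem hom_mult[of A A] by (simp add: one_PSL2R SL2R_simps(2))
  then have sq: "A ** A = mat 1 \<or> A ** A = - mat 1" by (simp add: to_PSL2R_eq_iff)
  have ne: "A \<noteq> mat 1" "A \<noteq> - mat 1"
    using ord H.ord_id by (auto simp: one_PSL2R to_PSL2R_uminus)
  have CH: "A ** A = trace A *\<^sub>R A - mat 1"
    using A by (simp add: mat2_simps algebra_simps)
  show ?thesis
  proof (rule ccontr)
    assume t: "trace A \<noteq> 0"
    have "trace A *\<^sub>R A = A ** A + mat 1" by (simp add: CH)
    then have "trace A *\<^sub>R A = mat 2 \<or> trace A *\<^sub>R A = mat 0"
      using sq by (auto simp: mat2_eq_iff mat2_mat_nth)
    then obtain k where "trace A *\<^sub>R A = mat k" by blast
    then have "A = mat (k / trace A)"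
      using t by (auto simp: mat2_eq_iff mat2_mat_nth field_simps)
    then obtain a where a: "A = mat a" by blast
    then have "a\<^sup>2 = 1" using A by (simp add: det_2 mat2_mat_nth power2_eq_square)
    then have "a = 1 \<or> a = -1" by (simp add: power2_eq_1_iff)
    then show False using ne a by (auto simp: mat2_simps)
  qed
qed

text \<open>Replacing \<open>A\<close> by \<open>- A\<close>, with the same image in PSL2, makes the
  traces equal. Trace different from 2 and -2 rules out scalars, so the matrices are conjugate, and
  conjugating the tuple realises \<open>A\<close> up to sign.\<close>

lemma to_PSL2R_word_value:
  assumes A: "det A = 1" "\<bar>trace A\<bar> \<noteq> 2"
    and g: "\<And>x. det (g x) = 1" and tr: "\<bar>trace (eval_word SL2R g w)\<bar> = \<bar>trace A\<bar>"
  obtains g' where "\<And>x. det (g' x) = 1" "to_PSL2R A = to_PSL2R (eval_word SL2R g' w)"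
proof -
  define W where "W = eval_word SL2R g w"
  have W: "det W = 1" unfolding W_def by (rule det_eval_word[OF g])
  obtain B where B: "B = A \<or> B = - A" "trace B = trace W"
    using tr by (force simp: W_def[symmetric] abs_eq_iff trace_2)
  have detB: "det B = 1" using B(1) A(1) by (auto simp: det_2)
  have ns: "C \<noteq> mat k" if "det C = 1" "\<bar>trace C\<bar> \<noteq> 2" for C :: "real ^ 2 ^ 2" and k
  proof
    assume C: "C = mat k"
    then have "k\<^sup>2 = 1" using that by (simp add: det_2 mat2_mat_nth power2_eq_square)
    then have "k = 1 \<or> k = -1" by (simp add: power2_eq_1_iff)
    then show False using that C by (auto simp: mat2_simps)
  qed
  obtain P Q where PQ: "P ** Q = mat 1" "Q ** P = mat 1" "B = P ** W ** Q"
    using conjugate_of_trace_eq[OF detB ns[OF detB] W ns[OF W]] B A(2) tr W_def by metis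
  have "det P * det Q = 1" using PQ(1) by (metis det_I det_mul)
  then have "det (P ** g x ** Q) = 1" for x using g by (simp add: det_mul)
  moreover have "to_PSL2R A = to_PSL2R (eval_word SL2R (\<lambda>x. P ** g x ** Q) w)"
    unfolding eval_word_conjugate[OF PQ(1,2) g] using B(1) PQ(3) W_def
    by (auto simp: to_PSL2R_eq_iff)
  ultimately show ?thesis using that[of "\<lambda>x. P ** g x ** Q"] by simp
qed

section \<open>The image of the word map\<close>

theorem proposition2p6:
  fixes d :: nat and w :: "(nat \<times> bool) list"
  assumes "d \<ge> 1"
    and "w \<in> carrier (free_group {1..d})"
    and "w \<noteq> \<one>\<^bsub>free_group {1..d}\<^esub>"
  shows "{h \<in> carrier PSL2R. PSL2R_split_semisimple h} \<subseteq> word_map_image PSL2R d w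
    \<and> ((\<exists>h \<in> carrier PSL2R. group.ord PSL2R h = 2 \<and> h \<in> word_map_image PSL2R d w)
        \<longrightarrow> {h \<in> carrier PSL2R. PSL2R_semisimple h} \<subseteq> word_map_image PSL2R d w)"
proof -
  have red: "reduced_word w" "w \<noteq> []" and letters: "fst ` set w \<subseteq> {1..d}"
    using assms(2,3) by (auto simp: free_group_def)
  note im = word_map_image_PSL2R[OF letters]
  \<comment> \<open>The trivial tuple covers the semisimple elements of absolute trace 2, to which
    the conjugacy argument does not apply.\<close>
  have one: "to_PSL2R (mat 1) \<in> word_map_image PSL2R d w"
    unfolding im by (intro image_eqI[where x = "\<lambda>_. mat 1"]) (simp_all add: eval_word_SL2R_one)
  have val: "to_PSL2R A \<in> word_map_image PSL2R d w"
    if A: "det A = 1" "\<bar>trace A\<bar> \<noteq> 2" and g: "\<And>x. det (g x) = 1"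
      and tr: "\<bar>trace A\<bar> \<in> closed_segment 2 \<bar>trace (eval_word SL2R g w)\<bar>" for A g
  proof -
    obtain g' where "\<And>x. det (g' x) = 1" "\<bar>trace (eval_word SL2R g' w)\<bar> = \<bar>trace A\<bar>"
      using word_trace_IVT[OF g tr] by metis
    then obtain g'' where "\<And>x. det (g'' x) = 1" "to_PSL2R A = to_PSL2R (eval_word SL2R g'' w)"
      using to_PSL2R_word_value[OF A] by metis
    then show ?thesis unfolding im by blast
  qed
  have large: "to_PSL2R A \<in> word_map_image PSL2R d w" if A: "det A = 1" "\<bar>trace A\<bar> > 2" for A
  proof -
    obtain g where "\<And>x. det (g x) = 1" "\<bar>trace (eval_word SL2R g w)\<bar> \<ge> \<bar>trace A\<bar>"
      using word_trace_unbounded[OF red] by metis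
    then show ?thesis using A by (intro val[of A g]) (auto simp: closed_segment_eq_real_ivl)
  qed
  have "to_PSL2R A \<in> word_map_image PSL2R d w" if "SL2R_split_semisimple A" for A
  proof (cases "\<bar>trace A\<bar> = 2")
    case False
    then show ?thesis
      using split_semisimple_trace(1)[OF that] that
      by (intro large) (auto simp: SL2R_split_semisimple_def SL2R_simps)
  qed (use split_semisimple_trace(2)[OF that] one in simp)
  moreover have "to_PSL2R A \<in> word_map_image PSL2R d w"
    if inv: "group.ord PSL2R h = 2" "h \<in> word_map_image PSL2R d w" and A: "SL2R_semisimple A" for A h
  proof -
    have det: "det A = 1" using A by (simp add: SL2R_semisimple_def SL2R_simps)
    obtain g where g: "\<And>x. det (g x) = 1" "h = to_PSL2R (eval_word SL2R g w)"
      using inv(2) unfolding im by auto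
    have "trace (eval_word SL2R g w) = 0"
      using involution_trace[OF det_eval_word[OF g(1)]] inv(1) g(2) by simp
    \<comment> \<open>The lifted involution has trace 0, so the segment between 0 and 2 reaches all
      elliptic elements.\<close>
    then have "to_PSL2R A \<in> word_map_image PSL2R d w" if "\<bar>trace A\<bar> < 2"
      using that by (intro val[of A g]) (auto simp: closed_segment_eq_real_ivl det g(1))
    then show ?thesis
      using large[OF det] semisimple_trace_2[OF A] one by fastforce
  qed
  ultimately show ?thesis
    by (auto simp: PSL2R_split_semisimple_def PSL2R_semisimple_def)
qed

end
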